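(* Let $G=(V,E)$ be a graph with a set $M\subseteq V$ of marked vertices, and let $|\psi\rangle$ be a state with the following properties: 1. all amplitudes of the unmarked vertices are equal, i.e. there is a scalar $a$ such that the amplitude of $|\psi\rangle$ at $|v,c\rangle$ is $a$ for every $v\in V\setminus M$ and every $0\le c<d_v$; 2. the sum of the amplitudes of any marked vertex is $0$, i.e. $\sum_{c=0}^{d_v-1}\langle v,c|\psi\rangle=0$ for every $v\in M$; 3. the amplitudes of two adjacent vertices pointing to each other are equal, i.e. $\langle v,c_{(v,w)}|\psi\rangle=\langle w,c_{(w,v)}|\psi\rangle$ for all adjacent $v,w\in V$. Then $|\psi\rangle$ is not changed by a step of the search algorithm, that is, $U'|\psi\rangle=|\psi\rangle$.
   Context: $G=(V,E)$ is a finite simple undirected graph with $n=|V|$, $m=|E|$; $d_v$ is the degree of the vertex $v$. For each vertex $v$ its incident edges are labelled by directions $c\in\{0,\dots,d_v-1\}$; for adjacent $v,w$, $c_{(v,w)}$ denotes the direction at $v$ pointing to $w$. The walk acts on the $2m$-dimensional complex Hilbert space with orthonormal basis $\{|v,c\rangle : v\in V,\ 0\le c<d_v\}$. Here "state" means a (not necessarily normalized) vector of this space; its amplitude at $|v,c\rangle$ is $\langle v,c|\psi\rangle$. A set $M\subseteq V$ of marked vertices is given. The operators are: - Query: $Q = I-2\sum_{w\in M}\sum_{c=0}^{d_w-1}|w,c\rangle\langle w,c|$. - Coin: $C=\bigoplus_{v\in V} C_{d_v}$, where $C_{d_v}$ acts on the span of $|v,0\rangle,\dots,|v,d_v-1\rangle$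 as the Grover diffusion $2|s_v\rangle\langle s_v|-I$ with $|s_v\rangle=\frac{1}{\sqrt{d_v}}\sum_{c=0}^{d_v-1}|v,c\rangle$. - Shift (flip-flop): $S|v,c_{(v,w)}\rangle=|w,c_{(w,v)}\rangle$ for every pair of adjacent vertices $v,w$. One step of the search algorithm is $U'=SCQ$. *)

theory Defs
  imports Complex_Main "Graph_Theory.Pair_Digraph"
begin

text \<open>
  Finite simple undirected graphs are the \<^locale>\<open>pair_graph\<close> digraphs: finite, loop-free and
  with a symmetric arc set, so that an undirected edge is a pair of opposite arcs and the
  degree of a vertex is its out-degree.
\<close>

abbreviation degree :: "'v pair_pre_digraph \<Rightarrow> 'v \<Rightarrow> nat" where
  "degree G v \<equiv> out_degree (with_proj G) v"

text \<open>\<open>dir v w\<close> is the direction at \<open>v\<close> pointing to its neighbour \<open>w\<close>.\<close>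

definition directions :: "'v pair_pre_digraph \<Rightarrow> ('v \<Rightarrow> 'v \<Rightarrow> nat) \<Rightarrow> bool" where
  "directions G dir \<longleftrightarrow>
     (\<forall>v \<in> pverts G. bij_betw (dir v) {w. (v, w) \<in> parcs G} {..<degree G v})"

text \<open>
  The basis of the Hilbert space depends on the graph. A vector is therefore its family of
  coordinates on all of \<open>'v \<times> nat\<close>, required to vanish outside the index set of the basis.
\<close>

type_synonym 'v state = "'v \<times> nat \<Rightarrow> complex"

definition basis_index :: "'v pair_pre_digraph \<Rightarrow> ('v \<times> nat) set" where
  "basis_index G = (SIGMA v : pverts G. {..<degree G v})"

definition states :: "'v pair_pre_digraph \<Rightarrow> 'v state set" where
  "states G = {\<psi>. \<forall>x. x \<notin> basis_index G \<longrightarrow> \<psi> x = 0}"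

definition ket :: "'v \<Rightarrow> nat \<Rightarrow> 'v state" where
  "ket v k = (\<lambda>x. if x = (v, k) then 1 else 0)"

definition braket :: "'v pair_pre_digraph \<Rightarrow> 'v state \<Rightarrow> 'v state \<Rightarrow> complex" where
  "braket G \<phi> \<psi> = (\<Sum>x \<in> basis_index G. cnj (\<phi> x) * \<psi> x)"

definition ketbra :: "'v pair_pre_digraph \<Rightarrow> 'v state \<Rightarrow> 'v state \<Rightarrow> 'v state \<Rightarrow> 'v state" where
  "ketbra G \<phi> \<chi> \<psi> = (\<lambda>x. braket G \<chi> \<psi> * \<phi> x)"

definition amplitude :: "'v pair_pre_digraph \<Rightarrow> 'v state \<Rightarrow> 'v \<Rightarrow> nat \<Rightarrow> complex" where
  "amplitude G \<psi> v k = braket G (ket v k) \<psi>"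

definition query :: "'v pair_pre_digraph \<Rightarrow> 'v set \<Rightarrow> 'v state \<Rightarrow> 'v state" where
  "query G M \<psi> =
     (\<lambda>x. \<psi> x - 2 * (\<Sum>w \<in> M. \<Sum>k < degree G w. ketbra G (ket w k) (ket w k) \<psi> x))"

definition uniform :: "'v pair_pre_digraph \<Rightarrow> 'v \<Rightarrow> 'v state" where
  "uniform G v =
     (\<lambda>x. 1 / complex_of_real (sqrt (real (degree G v))) * (\<Sum>k < degree G v. ket v k x))"

text \<open>
  The block \<open>grover G v\<close> is extended by \<open>0\<close> to the orthogonal complement of the span of the
  \<open>ket v k\<close>; the identity of its span is thus the projection \<open>\<Sum>k. ketbra G (ket v k) (ket v k)\<close>,
  and the direct sum of the blocks is their sum.
\<close>

definition grover :: "'v pair_pre_digraph \<Rightarrow> 'v \<Rightarrow> 'v state \<Rightarrow> 'v state" where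
  "grover G v \<psi> =
     (\<lambda>x. 2 * ketbra G (uniform G v) (uniform G v) \<psi> x
        - (\<Sum>k < degree G v. ketbra G (ket v k) (ket v k) \<psi> x))"

definition coin :: "'v pair_pre_digraph \<Rightarrow> 'v state \<Rightarrow> 'v state" where
  "coin G \<psi> = (\<lambda>x. \<Sum>v \<in> pverts G. grover G v \<psi> x)"

text \<open>
  The shift is the linear extension of its action on the basis, which is recovered in
  \<open>shift_ket\<close> below.
\<close>

definition shift :: "'v pair_pre_digraph \<Rightarrow> ('v \<Rightarrow> 'v \<Rightarrow> nat) \<Rightarrow> 'v state \<Rightarrow> 'v state" where
  "shift G dir \<psi> =
     (\<lambda>x. \<Sum>(v, w) \<in> parcs G. ketbra G (ket w (dir w v)) (ket v (dir v w)) \<psi> x)"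

definition search_step ::
    "'v pair_pre_digraph \<Rightarrow> ('v \<Rightarrow> 'v \<Rightarrow> nat) \<Rightarrow> 'v set \<Rightarrow> 'v state \<Rightarrow> 'v state" where
  "search_step G dir M = shift G dir \<circ> coin G \<circ> query G M"

lemma finite_basis_index: "pair_graph G \<Longrightarrow> finite (basis_index G)"
  unfolding basis_index_def
  by (intro finite_SigmaI)
    (auto simp: pair_graph_def pair_digraph_def pair_fin_digraph.pair_finite_verts)

lemma amplitude_eq:
  assumes "pair_graph G" "\<psi> \<in> states G"
  shows "amplitude G \<psi> v k = \<psi> (v, k)"
proof -
  have "amplitude G \<psi> v k = (\<Sum>x \<in> basis_index G. if x = (v, k) then \<psi> x else 0)"
    unfolding amplitude_def braket_def ket_def by (intro sum.cong) auto
  then show ?thesis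
    using assms finite_basis_index[OF assms(1)] by (auto simp: states_def)
qed

lemma ket_in_states:
  assumes "v \<in> pverts G" "k < degree G v"
  shows "ket v k \<in> states G"
  using assms by (auto simp: states_def ket_def basis_index_def)

lemma shift_ket:
  assumes G: "pair_graph G" and dir: "directions G dir" and e: "(v, w) \<in> parcs G"
  shows "shift G dir (ket v (dir v w)) = ket w (dir w v)"
proof
  fix x
  interpret pair_graph G by fact
  have inj: "inj_on (dir v) {w. (v, w) \<in> parcs G}" and v: "v \<in> pverts G"
    using dir e wellformed[OF e] by (auto simp: directions_def bij_betw_def)
  have lt: "dir v w < degree G v"
    using dir e v by (force simp: directions_def bij_betw_def)
  have amp: "braket G (ket a k) (ket v (dir v w)) = ket v (dir v w) (a, k)" for a k
    using amplitude_eq[OF G ket_in_states[OF v lt]] by (simp add: amplitude_def)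
  have "shift G dir (ket v (dir v w)) x
      = (\<Sum>p \<in> parcs G. if p = (v, w) then ket w (dir w v) x else 0)"
    unfolding shift_def ketbra_def amp
    using inj e by (intro sum.cong) (auto simp: ket_def inj_on_def split: if_splits)
  also have "\<dots> = ket w (dir w v) x"
    using e by simp
  finally show "shift G dir (ket v (dir v w)) x = ket w (dir w v) x" .
qed

end

theory Submission
  imports Defs
begin

text \<open>
  On a marked vertex the query flips the sign and the coin, whose amplitude sum there is \<open>0\<close>,
  flips it back; on an unmarked vertex the query does nothing and the coin fixes the constant
  vector. So coin and query together fix the state, and the flip-flop shift only exchanges
  amplitudes that are equal.
\<close>

lemma braket_ket:
  assumes "pair_graph G" "\<psi> \<in> states G"
  shows "braket G (ket v k) \<psi> = \<psi> (v, k)"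
  using amplitude_eq[OF assms] by (simp add: amplitude_def)

text \<open>The projections onto the basis vectors at \<open>v\<close> add up to the projection onto
  the block of \<open>v\<close>. The right side has no bound on \<open>j\<close> because \<psi>
  itself vanishes at \<open>(v, j)\<close> once \<open>j\<close> reaches the degree.\<close>

lemma sum_ketbra_ket:
  assumes "pair_graph G" "\<psi> \<in> states G"
  shows "(\<Sum>k < degree G v. ketbra G (ket v k) (ket v k) \<psi> (u, j)) = (if u = v then \<psi> (u, j) else 0)"
proof -
  have "(\<Sum>k < degree G v. ketbra G (ket v k) (ket v k) \<psi> (u, j))
      = (\<Sum>k < degree G v. if k = j then (if u = v then \<psi> (u, j) else 0) else 0)"
    \<comment> \<open>The brackets are evaluated before \<open>ket\<close> is unfolded, as unfolding
      would hide the pattern of \<open>braket_ket\<close>.\<close>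
    by (intro sum.cong) (auto simp: ketbra_def braket_ket[OF assms], auto simp: ket_def)
  also have "\<dots> = (if u = v then \<psi> (u, j) else 0)"
    using assms(2) by (auto simp: states_def basis_index_def)
  finally show ?thesis .
qed

text \<open>Only the summand \<open>w = v\<close> survives. Finiteness of \<open>M\<close> matters
  here: a sum over an infinite set defaults to 0.\<close>

lemma query_apply:
  assumes "pair_graph G" "finite M" "\<psi> \<in> states G"
  shows "query G M \<psi> (v, k) = (if v \<in> M then - \<psi> (v, k) else \<psi> (v, k))"
  using assms by (simp add: query_def sum_ketbra_ket)

lemma query_in_states:
  assumes "pair_graph G" "finite M" "\<psi> \<in> states G"
  shows "query G M \<psi> \<in> states G"
  using assms(3) by (auto simp: query_apply[OF assms] states_def)

lemma uniform_apply:
  "uniform G v (u, j) =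
     (if u = v \<and> j < degree G v then 1 / complex_of_real (sqrt (real (degree G v))) else 0)"
proof -
  have "(\<Sum>k < degree G v. ket v k (u, j))
      = (\<Sum>k < degree G v. if k = j then (if u = v then 1 else 0) else 0)"
    unfolding ket_def by (intro sum.cong) auto
  then show ?thesis
    by (auto simp: uniform_def)
qed

lemma braket_uniform:
  assumes "pair_graph G" "\<psi> \<in> states G"
  shows "braket G (uniform G v) \<psi> =
    1 / complex_of_real (sqrt (real (degree G v))) * (\<Sum>k < degree G v. \<psi> (v, k))"
proof -
  let ?c = "1 / complex_of_real (sqrt (real (degree G v)))"
  have "braket G (uniform G v) \<psi>
      = (\<Sum>x \<in> basis_index G. \<Sum>k < degree G v. ?c * (cnj (ket v k x) * \<psi> x))"
    unfolding braket_def uniform_def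
    by (intro sum.cong) (simp_all add: sum_distrib_left sum_distrib_right mult.assoc)
  also have "\<dots> = ?c * (\<Sum>k < degree G v. braket G (ket v k) \<psi>)"
    unfolding braket_def by (subst sum.swap) (simp add: sum_distrib_left)
  finally show ?thesis
    by (simp add: braket_ket[OF assms])
qed

text \<open>Inversion about the mean: the ket and the bra of \<open>uniform G v\<close> each
  contribute one factor \<open>1 / sqrt d\<close>, and \<open>sq\<close> merges them into
  \<open>1 / d\<close>.\<close>

lemma grover_apply:
  assumes "pair_graph G" "\<psi> \<in> states G"
  shows "grover G v \<psi> (u, j) =
    (if u = v \<and> j < degree G v
     then 2 / of_nat (degree G v) * (\<Sum>k < degree G v. \<psi> (v, k)) - \<psi> (v, j) else 0)"
proof -
  have sq: "complex_of_real (sqrt (real d)) * complex_of_real (sqrt (real d)) = of_nat d" for d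
    by (simp flip: of_real_mult)
  have "\<not> j < degree G v \<Longrightarrow> \<psi> (v, j) = 0"
    using assms(2) by (auto simp: states_def basis_index_def)
  then show ?thesis
    unfolding grover_def sum_ketbra_ket[OF assms]
    by (auto simp: ketbra_def braket_uniform[OF assms] uniform_apply sq)
qed

lemma coin_apply:
  assumes "pair_graph G" "\<psi> \<in> states G"
  shows "coin G \<psi> (v, k) =
    (if (v, k) \<in> basis_index G
     then 2 / of_nat (degree G v) * (\<Sum>j < degree G v. \<psi> (v, j)) - \<psi> (v, k) else 0)"
proof -
  interpret pair_graph G by fact
  have "coin G \<psi> (v, k) = (\<Sum>u \<in> pverts G. if u = v then grover G v \<psi> (v, k) else 0)"
    unfolding coin_def by (intro sum.cong) (auto simp: grover_apply[OF assms])
  then show ?thesis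
    by (simp add: grover_apply[OF assms] basis_index_def)
qed

text \<open>Surjectivity of \<open>dir v\<close> onto the directions at \<open>v\<close> turns a
  claim about basis indices into one about arcs.\<close>

lemma basis_index_arcE:
  assumes "directions G dir" "(v, k) \<in> basis_index G"
  obtains w where "(v, w) \<in> parcs G" "k = dir v w"
proof -
  have "k \<in> dir v ` {w. (v, w) \<in> parcs G}"
    using assms by (auto simp: directions_def basis_index_def bij_betw_def)
  then show thesis
    using that by auto
qed

lemma arc_in_basis_index:
  assumes "pair_graph G" "directions G dir" "(v, w) \<in> parcs G"
  shows "(v, dir v w) \<in> basis_index G"
proof -
  interpret pair_graph G by fact
  have "v \<in> pverts G"
    using wellformed[OF assms(3)] by simp
  with assms(2,3) show ?thesis
    by (force simp: directions_def basis_index_def bij_betw_def)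
qed

lemma shift_apply_arc:
  assumes G: "pair_graph G" and dir: "directions G dir" and \<psi>: "\<psi> \<in> states G"
    and e: "(v, w) \<in> parcs G"
  shows "shift G dir \<psi> (v, dir v w) = \<psi> (w, dir w v)"
proof -
  interpret pair_graph G by fact
  have e': "(w, v) \<in> parcs G"
    using e by (rule arcs_symmetric)
  have inj: "inj_on (dir v) {w. (v, w) \<in> parcs G}"
    using dir wellformed[OF e] by (auto simp: directions_def bij_betw_def)
  have "shift G dir \<psi> (v, dir v w)
      = (\<Sum>p \<in> parcs G. if p = (w, v) then \<psi> (w, dir w v) else 0)"
    unfolding shift_def ketbra_def braket_ket[OF G \<psi>]
    using inj e arcs_symmetric
    by (intro sum.cong) (auto simp: ket_def inj_on_def split: if_splits)
  then show ?thesis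
    using e' by simp
qed

text \<open>The output combines kets \<open>ket w (dir w v)\<close> of reversed arcs, all of which
  are basis vectors, whatever \<psi> is.\<close>

lemma shift_in_states:
  assumes "pair_graph G" "directions G dir"
  shows "shift G dir \<psi> \<in> states G"
proof -
  interpret pair_graph G by fact
  have "ket w (dir w v) x = 0" if "x \<notin> basis_index G" "(v, w) \<in> parcs G" for v w x
    using that arc_in_basis_index[OF assms, of w v] arcs_symmetric by (auto simp: ket_def)
  then show ?thesis
    unfolding states_def shift_def ketbra_def by (auto intro!: sum.neutral)
qed

theorem theorem5:
  fixes G :: "'v pair_pre_digraph" and dir :: "'v \<Rightarrow> 'v \<Rightarrow> nat"
    and M :: "'v set" and \<psi> :: "'v state"
  assumes graph: "pair_graph G"
    and dir: "directions G dir"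
    and marked: "M \<subseteq> pverts G"
    and state: "\<psi> \<in> states G"
    and unmarked_equal:
      "\<exists>a. \<forall>v \<in> pverts G - M. \<forall>k < degree G v. amplitude G \<psi> v k = a"
    and marked_sum: "\<forall>v \<in> M. (\<Sum>k < degree G v. amplitude G \<psi> v k) = 0"
    and pointing_equal:
      "\<forall>v w. (v, w) \<in> parcs G \<longrightarrow> amplitude G \<psi> v (dir v w) = amplitude G \<psi> w (dir w v)"
  shows "search_step G dir M \<psi> = \<psi>"
proof -
  interpret pair_graph G by fact
  have finM: "finite M"
    using marked by (rule finite_subset) simp
  note amp = amplitude_eq[OF graph state]
  let ?\<phi> = "query G M \<psi>"
  have \<phi>: "?\<phi> \<in> states G"
    by (rule query_in_states[OF graph finM state])
  have "coin G ?\<phi> = \<psi>"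
  proof (rule ext, clarify)
    fix v k
    show "coin G ?\<phi> (v, k) = \<psi> (v, k)"
    \<comment> \<open>The equation is between functions on all pairs, so indices outside the basis
      must be checked too; there both sides are 0.\<close>
    proof (cases "(v, k) \<in> basis_index G")
      case False
      then show ?thesis
        using state by (simp add: coin_apply[OF graph \<phi>] states_def)
    next
      case True
      then have v: "v \<in> pverts G" and k: "k < degree G v"
        by (auto simp: basis_index_def)
      show ?thesis
      proof (cases "v \<in> M")
        case True
        then show ?thesis
          using \<open>(v, k) \<in> basis_index G\<close> marked_sum
          by (simp add: coin_apply[OF graph \<phi>] query_apply[OF graph finM state] amp sum_negf)
      next
        case False
        with unmarked_equal v obtain a where "\<forall>j < degree G v. \<psi> (v, j) = a"
          unfolding amp by blast
        \<comment> \<open>The coin yields \<open>2 / d * (d * a) - a = a\<close>; the cancellation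
          is sound because \<open>k < d\<close> forces \<open>d\<close> to be nonzero.\<close>
        then show ?thesis
          using \<open>(v, k) \<in> basis_index G\<close> False k
          by (simp add: coin_apply[OF graph \<phi>] query_apply[OF graph finM state])
      qed
    qed
  qed
  moreover have "shift G dir \<psi> = \<psi>"
  proof (rule ext, clarify)
    fix v k
    show "shift G dir \<psi> (v, k) = \<psi> (v, k)"
    proof (cases "(v, k) \<in> basis_index G")
      case True
      with dir obtain w where "(v, w) \<in> parcs G" "k = dir v w"
        by (rule basis_index_arcE)
      then show ?thesis
        using pointing_equal shift_apply_arc[OF graph dir state] unfolding amp by metis
    next
      case False
      then show ?thesis
        using state shift_in_states[OF graph dir] by (simp add: states_def)
    qed
  qed
  ultimately show ?thesis
    by (simp add: search_step_def)
qed

end
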